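(* Let $H$ be a complex Hilbert space and let $A \in B(H)$ be supraposinormal with interrupter pair $(Q,P)$; that is, $P, Q \in B(H)$ are positive operators, at least one of which has dense range, and $AQA^* = A^*PA$. (i) If there exist constants $\delta_1, \delta_2 > 0$ such that $\delta_1 Q \geq I \geq \delta_2 P \geq 0$, then $A$ is posinormal. (ii) If there exist constants $\delta_1, \delta_2 > 0$ with $\delta_1 \leq \delta_2$ such that $\delta_1 Q \geq I \geq \delta_2 P \geq 0$, then $A$ is hyponormal.
   Context: $B(H)$ denotes the bounded linear operators on $H$ and $I$ the identity. "Positive" means positive semidefinite: $\langle Tf,f\rangle \geq 0$ for all $f \in H$; $S \geq T$ means $S-T$ is positive. An operator $T \in B(H)$ is posinormal if there exists a positive operator $R \in B(H)$ with $TT^* = T^*RT$; equivalently, $\gamma^2 T^*T \geq TT^*$ for some $\gamma \geq 0$. $T$ is hyponormal if $T^*T \geq TT^*$. $T \in B(H)$ is supraposinormal if there exist positive operators $P,Q \in B(H)$, at least one of which has dense range, such that $TQT^* = T^*PT$; then $(Q,P)$ is called an interrupter pair associated with $T$. *)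

theory Defs
  imports "HOL-Analysis.Analysis"
begin

class complex_vector = real_vector +
  fixes scaleC :: "complex \<Rightarrow> 'a \<Rightarrow> 'a" (infixr "*\<^sub>C" 75)
  assumes scaleC_add_right: "c *\<^sub>C (x + y) = c *\<^sub>C x + c *\<^sub>C y"
    and scaleC_add_left: "(c + d) *\<^sub>C x = c *\<^sub>C x + d *\<^sub>C x"
    and scaleC_scaleC: "c *\<^sub>C d *\<^sub>C x = (c * d) *\<^sub>C x"
    and scaleC_one: "1 *\<^sub>C x = x"
    and scaleC_of_real: "complex_of_real r *\<^sub>C x = r *\<^sub>R x"

text \<open>
  The complex inner product is linear in its first argument. Extending \<open>real_inner\<close>, with the real
  inner product required to be the real part of the complex one, makes the library's norm and
  topology the ones induced by \<open>cinner\<close>. The positive definiteness of \<open>cinner\<close> is then a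
  consequence (\<open>cinner_self\<close>, \<open>cinner_self_eq_0_iff\<close>) and need not be an axiom.
\<close>

class complex_inner = complex_vector + real_inner +
  fixes cinner :: "'a \<Rightarrow> 'a \<Rightarrow> complex"
  assumes cinner_commute: "cinner x y = cnj (cinner y x)"
    and cinner_add_left: "cinner (x + y) z = cinner x z + cinner y z"
    and cinner_scaleC_left: "cinner (c *\<^sub>C x) y = c * cinner x y"
    and Re_cinner: "Re (cinner x y) = inner x y"

class chilbert_space = complex_inner + complete_space

lemma cinner_self: "cinner x x = complex_of_real ((norm (x :: 'a :: complex_inner))\<^sup>2)"
proof (rule complex_eqI)
  show "Im (cinner x x) = Im (complex_of_real ((norm x)\<^sup>2))"
    using cinner_commute[of x x] by (simp add: complex_eq_iff)
qed (simp add: Re_cinner dot_square_norm)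

lemma cinner_self_eq_0_iff: "cinner x x = 0 \<longleftrightarrow> (x :: 'a :: complex_inner) = 0"
  by (simp add: cinner_self)

instantiation complex :: chilbert_space
begin

definition scaleC_complex :: "complex \<Rightarrow> complex \<Rightarrow> complex" where
  "scaleC_complex c x = c * x"

definition cinner_complex :: "complex \<Rightarrow> complex \<Rightarrow> complex" where
  "cinner_complex x y = x * cnj y"

instance
  by standard
    (simp_all add: scaleC_complex_def cinner_complex_def algebra_simps scaleR_conv_of_real
      inner_complex_def)

end

definition bounded_clinear :: "('a :: complex_inner \<Rightarrow> 'a) \<Rightarrow> bool" where
  "bounded_clinear T \<longleftrightarrow> bounded_linear T \<and> (\<forall>c f. T (c *\<^sub>C f) = c *\<^sub>C T f)"

text \<open>
  On a Hilbert space, existence and uniqueness of the adjoint of a bounded operator (Riesz) make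
  the following description proper; it carries no information for other functions.
\<close>

definition cadjoint :: "('a :: chilbert_space \<Rightarrow> 'a) \<Rightarrow> 'a \<Rightarrow> 'a" where
  "cadjoint T = (THE S. bounded_clinear S \<and> (\<forall>f g. cinner (T f) g = cinner f (S g)))"

text \<open>
  Here \<open>\<real>\<^sub>\<ge>\<^sub>0\<close> is a set of complex numbers: the quadratic form is real valued and nonnegative.
\<close>

definition positive_op :: "('a :: chilbert_space \<Rightarrow> 'a) \<Rightarrow> bool" where
  "positive_op T \<longleftrightarrow> bounded_clinear T \<and> (\<forall>f. cinner (T f) f \<in> \<real>\<^sub>\<ge>\<^sub>0)"

definition op_ge :: "('a :: chilbert_space \<Rightarrow> 'a) \<Rightarrow> ('a \<Rightarrow> 'a) \<Rightarrow> bool"  (infix "\<ge>\<^sub>o\<^sub>p" 50) where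
  "S \<ge>\<^sub>o\<^sub>p T \<longleftrightarrow> positive_op (\<lambda>f. S f - T f)"

definition dense_range :: "('a :: chilbert_space \<Rightarrow> 'a) \<Rightarrow> bool" where
  "dense_range T \<longleftrightarrow> closure (range T) = UNIV"

definition posinormal :: "('a :: chilbert_space \<Rightarrow> 'a) \<Rightarrow> bool" where
  "posinormal T \<longleftrightarrow> bounded_clinear T \<and>
     (\<exists>R. positive_op R \<and> T \<circ> cadjoint T = cadjoint T \<circ> R \<circ> T)"

definition hyponormal :: "('a :: chilbert_space \<Rightarrow> 'a) \<Rightarrow> bool" where
  "hyponormal T \<longleftrightarrow> bounded_clinear T \<and> (cadjoint T \<circ> T) \<ge>\<^sub>o\<^sub>p (T \<circ> cadjoint T)"

definition interrupter_pair ::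
    "('a :: chilbert_space \<Rightarrow> 'a) \<Rightarrow> ('a \<Rightarrow> 'a) \<Rightarrow> ('a \<Rightarrow> 'a) \<Rightarrow> bool" where
  "interrupter_pair T Q P \<longleftrightarrow> positive_op Q \<and> positive_op P \<and> (dense_range Q \<or> dense_range P) \<and>
     T \<circ> Q \<circ> cadjoint T = cadjoint T \<circ> P \<circ> T"

definition supraposinormal :: "('a :: chilbert_space \<Rightarrow> 'a) \<Rightarrow> bool" where
  "supraposinormal T \<longleftrightarrow> bounded_clinear T \<and> (\<exists>Q P. interrupter_pair T Q P)"

end

theory Submission
  imports Defs
begin

text \<open>
  Since \<open>\<delta>\<^sub>1 Q \<ge> I\<close> and \<open>I \<ge> \<delta>\<^sub>2 P\<close>, testing \<open>A Q A* = A* P A\<close> against \<open>f\<close> gives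
  \<open>\<parallel>A* f\<parallel>\<^sup>2 \<le> \<delta>\<^sub>1 \<langle>P A f, A f\<rangle> \<le> (\<delta>\<^sub>1 / \<delta>\<^sub>2) \<parallel>A f\<parallel>\<^sup>2\<close>, which is hyponormality when
  \<open>\<delta>\<^sub>1 \<le> \<delta>\<^sub>2\<close>. In general Douglas factorization turns it into \<open>A = A* W\<close> with \<open>W\<close> bounded; then
  \<open>A* = W* A\<close> and \<open>A A* = A* (W W*) A\<close>.
\<close>

section \<open>Riesz representation by minimization\<close>

text \<open>
  For \<open>A = id\<close> this is the Riesz representation theorem. The vector \<open>h\<close> is the limit of \<open>A f\<close>
  along a minimizing sequence of the functional \<open>\<parallel>A f\<parallel>\<^sup>2 - 2 l f\<close>.
\<close>

lemma riesz_closure_range: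
  fixes A :: "'b :: real_vector \<Rightarrow> 'a :: {real_inner, complete_space}" and l :: "'b \<Rightarrow> real"
  assumes A: "linear A" and l: "linear l" and bound: "\<And>f. \<bar>l f\<bar> \<le> C * norm (A f)"
  shows "\<exists>h \<in> closure (range A). \<forall>f. inner (A f) h = l f"
proof -
  interpret A: linear A by (rule A)
  interpret l: linear l by (rule l)
  define J where "J f = (norm (A f))\<^sup>2 - 2 * l f" for f
  have J_ge: "J f \<ge> - C\<^sup>2" for f
  proof -
    have "0 \<le> (norm (A f) - C)\<^sup>2" by simp
    then show ?thesis
      using bound[of f] by (simp add: J_def power2_diff mult.commute abs_le_iff)
  qed
  define m where "m = (INF f. J f)"
  have bdd: "bdd_below (range J)"
    using J_ge by (auto intro!: bdd_belowI)
  have m_le: "m \<le> J f" for f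
    unfolding m_def by (rule cINF_lower[OF bdd]) simp
  have "\<exists>f. J f < m + 1 / real (Suc n)" for n
    using cInf_lessD[of "range J" "m + 1 / real (Suc n)"] by (auto simp: m_def)
  then obtain u where u: "\<And>n. J (u n) < m + 1 / real (Suc n)" by metis
  \<comment> \<open>The terms in \<open>l\<close> cancel, leaving the parallelogram law. Since
    \<open>J\<close> at the midpoint is at least \<open>m\<close>, near-minimizers have close images
    under \<open>A\<close>, although \<open>u\<close> itself need not converge.\<close>
  have parallelogram: "(norm (A f - A g))\<^sup>2 = 2 * J f + 2 * J g - 4 * J ((1/2) *\<^sub>R (f + g))" for f g
    by (simp add: J_def A.add A.scale l.add l.scale power2_norm_eq_inner inner_commute
        algebra_simps)
  have dist_u: "(norm (A (u i) - A (u j)))\<^sup>2 \<le> 2 / real (Suc i) + 2 / real (Suc j)" for i j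
    using parallelogram[of "u i" "u j"] u[of i] u[of j] m_le[of "(1/2) *\<^sub>R (u i + u j)"] by simp
  have "Cauchy (\<lambda>n. A (u n))"
  proof (rule metric_CauchyI)
    fix e :: real assume e: "e > 0"
    then obtain M where M: "1 / real (Suc M) < e\<^sup>2 / 4"
      using reals_Archimedean[of "e\<^sup>2 / 4"] by (auto simp: inverse_eq_divide)
    have "dist (A (u i)) (A (u j)) < e" if "i \<ge> M" "j \<ge> M" for i j
    proof -
      have "1 / real (Suc k) \<le> 1 / real (Suc M)" if "k \<ge> M" for k
        using that by (intro divide_left_mono) auto
      from this[OF that(1)] this[OF that(2)] have "(norm (A (u i) - A (u j)))\<^sup>2 < e\<^sup>2"
        using dist_u[of i j] M by simp
      then show ?thesis
        using e by (simp add: dist_norm power_less_imp_less_base)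
    qed
    then show "\<exists>M. \<forall>i\<ge>M. \<forall>j\<ge>M. dist (A (u i)) (A (u j)) < e" by blast
  qed
  then obtain h where h: "(\<lambda>n. A (u n)) \<longlonglongrightarrow> h"
    using Cauchy_convergent_iff convergent_def by blast
  have "inner (A f) h = l f" for f
  proof -
    define d where "d = inner (A f) h - l f"
    \<comment> \<open>First variation at the minimum: moving \<open>u n\<close> by
      \<open>t *\<^sub>R f\<close> can lower \<open>J\<close> by less than
      \<open>1 / real (Suc n)\<close>, and the limit in \<open>n\<close> gives the claim.\<close>
    have quad: "0 \<le> 2 * t * d + t\<^sup>2 * (norm (A f))\<^sup>2" for t
    proof -
      define D where "D n = 2 * t * (inner (A f) (A (u n)) - l f) + t\<^sup>2 * (norm (A f))\<^sup>2" for n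
      have "J (u n + t *\<^sub>R f) = J (u n) + D n" for n
      proof -
        have "(norm (A (u n + t *\<^sub>R f)))\<^sup>2
            = (norm (A (u n)))\<^sup>2 + 2 * t * inner (A f) (A (u n)) + t\<^sup>2 * (norm (A f))\<^sup>2"
          unfolding A.add A.scale power2_norm_eq_inner
          by (simp add: inner_commute power2_eq_square algebra_simps)
        then show ?thesis
          by (simp add: J_def D_def l.add l.scale algebra_simps)
      qed
      then have "0 \<le> 1 / real (Suc n) + D n" for n
        using m_le[of "u n + t *\<^sub>R f"] u[of n] by simp
      moreover have "(\<lambda>n. 1 / real (Suc n) + D n) \<longlonglongrightarrow> 0 + (2 * t * d + t\<^sup>2 * (norm (A f))\<^sup>2)"
        unfolding D_def d_def using LIMSEQ_inverse_real_of_nat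
        by (intro tendsto_intros h) (simp add: inverse_eq_divide)
      ultimately show ?thesis
        using LIMSEQ_le_const[of _ _ 0] by (smt (verit))
    qed
    \<comment> \<open>The value \<open>t = - d / a\<close> makes the quadratic negative unless
      \<open>d = 0\<close>. The summand 1 keeps \<open>a\<close> positive even when
      \<open>A f = 0\<close>.\<close>
    define a where "a = (norm (A f))\<^sup>2 + 1"
    have "0 \<le> 2 * (- d / a) * d + (- d / a)\<^sup>2 * (norm (A f))\<^sup>2" by (rule quad)
    also have "\<dots> = - (d\<^sup>2 * (a + 1)) / a\<^sup>2"
    proof -
      have "a > 0" by (simp add: a_def add_nonneg_pos)
      moreover have "(norm (A f))\<^sup>2 = a - 1" by (simp add: a_def)
      ultimately show ?thesis
        by (simp only:) (simp add: field_simps power2_eq_square)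
    qed
    finally have "d\<^sup>2 * (a + 1) / a\<^sup>2 \<le> 0" by simp
    moreover have "a > 0" by (simp add: a_def add_nonneg_pos)
    ultimately have "d\<^sup>2 \<le> 0"
      by (simp add: divide_le_0_iff mult_le_0_iff)
    then show ?thesis by (simp add: d_def)
  qed
  moreover have "h \<in> closure (range A)"
    unfolding closure_sequential using h by (intro exI[where x = "\<lambda>n. A (u n)"]) simp
  ultimately show ?thesis by blast
qed

section \<open>Complex inner products and bounded operators\<close>

lemma cinner_scaleC_right: "cinner x (c *\<^sub>C y) = cnj c * cinner x y"
  by (metis cinner_commute cinner_scaleC_left complex_cnj_mult)

lemma cinner_diff_left: "cinner (x - y) z = cinner x z - cinner y z"
  by (metis add_diff_cancel cinner_add_left diff_add_cancel)

lemma inner_scaleC_left: "inner (c *\<^sub>C x) y = inner x (cnj c *\<^sub>C y)"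
  for x y :: "'a :: complex_inner"
  by (simp flip: Re_cinner add: cinner_scaleC_left cinner_scaleC_right)

lemma Im_cinner: "Im (cinner x y) = - inner (\<i> *\<^sub>C x) y"
  by (simp flip: Re_cinner add: cinner_scaleC_left)

lemma norm_scaleC: "norm (c *\<^sub>C x) = cmod c * norm x" for x :: "'a :: complex_inner"
proof -
  have "cinner (c *\<^sub>C x) (c *\<^sub>C x) = complex_of_real ((cmod c)\<^sup>2) * cinner x x"
    unfolding complex_norm_square by (simp add: cinner_scaleC_left cinner_scaleC_right)
  then have "(norm (c *\<^sub>C x))\<^sup>2 = (cmod c * norm x)\<^sup>2"
    by (simp only: cinner_self of_real_eq_iff power_mult_distrib flip: of_real_mult)
  then show ?thesis by simp
qed

lemma bounded_linear_scaleC: "bounded_linear (\<lambda>x :: 'a :: complex_inner. c *\<^sub>C x)"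
proof (rule bounded_linear_intro[where K = "cmod c"])
  fix r :: real and x :: 'a
  show "c *\<^sub>C r *\<^sub>R x = r *\<^sub>R c *\<^sub>C x"
    by (simp add: scaleC_scaleC mult.commute flip: scaleC_of_real)
qed (simp_all add: scaleC_add_right norm_scaleC mult.commute)

lemma cinner_ext:
  assumes "\<And>f. cinner f x = cinner f y"
  shows "x = y"
  using assms Re_cinner by (metis vector_eq_ldot)

lemma bounded_clinear_comp:
  "bounded_clinear S \<Longrightarrow> bounded_clinear T \<Longrightarrow> bounded_clinear (S \<circ> T)"
  by (auto simp: bounded_clinear_def o_def intro: bounded_linear_compose)

lemma bounded_clinear_diff:
  assumes "bounded_clinear S" "bounded_clinear T"
  shows "bounded_clinear (\<lambda>f. S f - T f)"
proof -
  have "c *\<^sub>C (x - y) = c *\<^sub>C x - c *\<^sub>C y" for c and x y :: 'a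
    by (metis add_diff_cancel diff_add_cancel scaleC_add_right)
  then show ?thesis
    using assms by (auto simp: bounded_clinear_def intro: bounded_linear_sub)
qed

section \<open>Douglas factorization\<close>

lemma subspace_closure:
  fixes S :: "'a :: real_normed_vector set"
  assumes S: "subspace S"
  shows "subspace (closure S)"
proof (rule subspaceI)
  show "0 \<in> closure S"
    using closure_subset subspace_0[OF S] by blast
next
  fix x y assume "x \<in> closure S" "y \<in> closure S"
  then obtain u v where "\<And>n. u n \<in> S" "u \<longlonglongrightarrow> x" "\<And>n. v n \<in> S" "v \<longlonglongrightarrow> y"
    unfolding closure_sequential by blast
  then have "\<forall>n. u n + v n \<in> S" "(\<lambda>n. u n + v n) \<longlonglongrightarrow> x + y"
    by (auto intro: subspace_add[OF S] tendsto_add)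
  then show "x + y \<in> closure S"
    unfolding closure_sequential by (intro exI[where x = "\<lambda>n. u n + v n"] conjI)
next
  fix c x assume "x \<in> closure S"
  then obtain u where "\<And>n. u n \<in> S" "u \<longlonglongrightarrow> x"
    unfolding closure_sequential by blast
  then have "\<forall>n. c *\<^sub>R u n \<in> S" "(\<lambda>n. c *\<^sub>R u n) \<longlonglongrightarrow> c *\<^sub>R x"
    by (auto intro: subspace_scale[OF S] tendsto_scaleR)
  then show "c *\<^sub>R x \<in> closure S"
    unfolding closure_sequential by (intro exI[where x = "\<lambda>n. c *\<^sub>R u n"] conjI)
qed

text \<open>The bound makes each functional sending \<open>A f\<close> to the inner product of
  \<open>T f\<close> and \<open>g\<close> well defined and bounded on the range of \<open>A\<close>;
  \<open>W g\<close> represents it. In terms of adjoints, \<open>W\<close> satisfies A* W = T*. The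
  weak form avoids adjoints, whose existence is derived from this theorem.\<close>

theorem douglas_factorization:
  fixes A T :: "'a :: chilbert_space \<Rightarrow> 'a"
  assumes A: "bounded_clinear A" and T: "bounded_clinear T"
    and bound: "\<And>f. norm (T f) \<le> C * norm (A f)"
  shows "\<exists>W. bounded_clinear W \<and> (\<forall>f g. cinner (A f) (W g) = cinner (T f) g)"
proof -
  interpret A: bounded_linear A using A by (simp add: bounded_clinear_def)
  interpret T: bounded_linear T using T by (simp add: bounded_clinear_def)
  have A_scaleC: "A (c *\<^sub>C f) = c *\<^sub>C A f" and T_scaleC: "T (c *\<^sub>C f) = c *\<^sub>C T f" for c f
    using A T by (simp_all add: bounded_clinear_def)
  let ?S = "closure (range A)"
  have "\<exists>h \<in> ?S. \<forall>f. inner (A f) h = inner (T f) g" for g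
  proof (rule riesz_closure_range)
    show "linear A" by (rule A.linear)
    show "linear (\<lambda>f. inner (T f) g)"
      by (intro bounded_linear.linear bounded_linear_inner_left_comp T.bounded_linear)
    show "\<bar>inner (T f) g\<bar> \<le> (C * norm g) * norm (A f)" for f
      using Cauchy_Schwarz_ineq2[of "T f" g] mult_right_mono[OF bound[of f], of "norm g"]
      by (simp add: mult_ac)
  qed
  then obtain W where W_mem: "\<And>g. W g \<in> ?S"
    and W: "\<And>f g. inner (A f) (W g) = inner (T f) g" by metis
  have sub: "subspace ?S"
    by (intro subspace_closure linear_subspace_image A.linear subspace_UNIV)
  have zero: "x = 0" if x: "x \<in> ?S" and orth: "\<And>f. inner (A f) x = 0" for x
  proof -
    have "?S \<subseteq> {y. inner y x = 0}"
      using orth by (intro closure_minimal closed_Collect_eq continuous_intros) auto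
    then show ?thesis using x by auto
  qed
  \<comment> \<open>\<open>W\<close> is chosen pointwise; its linearity comes from uniqueness of the
    representing vector inside \<open>?S\<close>.\<close>
  have uniq: "x = W g" if "x \<in> ?S" "\<And>f. inner (A f) x = inner (T f) g" for x g
    using zero[of "x - W g"] that W W_mem by (simp add: inner_diff_right subspace_diff[OF sub])
  \<comment> \<open>\<open>subspace\<close> covers real scalars only; complex ones use the complex
    linearity of \<open>A\<close> and continuity.\<close>
  have scaleC_mem: "c *\<^sub>C x \<in> ?S" if "x \<in> ?S" for c x
  proof -
    have "(\<lambda>x. c *\<^sub>C x) ` ?S \<subseteq> ?S"
    proof (rule image_closure_subset)
      show "continuous_on ?S (\<lambda>x. c *\<^sub>C x)"
        by (rule linear_continuous_on[OF bounded_linear_scaleC])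
      show "(\<lambda>x. c *\<^sub>C x) ` range A \<subseteq> ?S"
        using closure_subset by (fastforce simp flip: A_scaleC)
    qed simp
    then show ?thesis using that by blast
  qed
  have W_scaleC: "W (c *\<^sub>C g) = c *\<^sub>C W g" for c g
    using W[of "cnj c *\<^sub>C _" g]
    by (intro uniq[symmetric] scaleC_mem W_mem) (simp add: A_scaleC T_scaleC inner_scaleC_left)
  have W_bound: "norm (W g) \<le> norm g * \<bar>C\<bar>" for g
  proof -
    \<comment> \<open>An inequality closed in \<open>y\<close> passes from the range to its closure,
      where \<open>y = W g\<close> is admissible. The absolute value is taken because
      \<open>C\<close> may be negative.\<close>
    have "range A \<subseteq> {y. inner y (W g) \<le> (\<bar>C\<bar> * norm g) * norm y}"
    proof clarsimp
      fix f
      have "inner (A f) (W g) \<le> norm (T f) * norm g"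
        by (simp add: W norm_cauchy_schwarz)
      also have "\<dots> \<le> (\<bar>C\<bar> * norm (A f)) * norm g"
        by (intro mult_right_mono order_trans[OF bound]) simp_all
      finally show "inner (A f) (W g) \<le> \<bar>C\<bar> * norm g * norm (A f)" by (simp add: mult_ac)
    qed
    then have "?S \<subseteq> {y. inner y (W g) \<le> (\<bar>C\<bar> * norm g) * norm y}"
      by (intro closure_minimal closed_Collect_le continuous_intros)
    then have "norm (W g) * norm (W g) \<le> (\<bar>C\<bar> * norm g) * norm (W g)"
      using W_mem[of g] by (auto simp flip: power2_norm_eq_inner power2_eq_square)
    then show ?thesis
      by (cases "W g = 0") (auto simp: mult.commute)
  qed
  have "bounded_linear W"
  proof (rule bounded_linear_intro[OF _ _ W_bound])
    show "W (x + y) = W x + W y" for x y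
      by (intro uniq[symmetric] subspace_add[OF sub] W_mem) (simp add: inner_add_right W)
    show "W (r *\<^sub>R x) = r *\<^sub>R W x" for r x
      by (simp add: W_scaleC flip: scaleC_of_real)
  qed
  \<comment> \<open>The real identity at \<open>\<i> *\<^sub>C f\<close> supplies the imaginary
    part.\<close>
  moreover have "cinner (A f) (W g) = cinner (T f) g" for f g
    using W[of f g] W[of "\<i> *\<^sub>C f" g]
    by (simp add: complex_eq_iff Re_cinner Im_cinner A_scaleC T_scaleC)
  ultimately show ?thesis
    using W_scaleC by (auto simp: bounded_clinear_def)
qed

section \<open>Adjoints\<close>

text \<open>Existence is the factorization with \<open>id\<close> in the role of \<open>A\<close>;
  uniqueness then identifies the solution with the description defining
  \<open>cadjoint\<close>.\<close>

lemma
  assumes T: "bounded_clinear T"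
  shows bounded_clinear_cadjoint: "bounded_clinear (cadjoint T)"
    and cinner_cadjoint_right: "cinner f (cadjoint T g) = cinner (T f) g"
proof -
  let ?adj = "\<lambda>S. bounded_clinear S \<and> (\<forall>f g. cinner (T f) g = cinner f (S g))"
  obtain C where "\<And>f. norm (T f) \<le> norm f * C"
    using T bounded_linear.bounded by (metis bounded_clinear_def)
  then have "\<exists>S. bounded_clinear S \<and> (\<forall>f g. cinner (id f) (S g) = cinner (T f) g)"
    by (intro douglas_factorization[where C = C] T)
      (simp_all add: bounded_clinear_def mult.commute bounded_linear_ident[folded id_def])
  then obtain S where S: "?adj S" by (metis id_apply)
  have uniq: "S' = S" if S': "?adj S'" for S'
  proof (rule ext)
    fix g
    have "cinner f (S' g) = cinner f (S g)" for f
      using S S' by metis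
    then show "S' g = S g" by (rule cinner_ext)
  qed
  have "cadjoint T = S"
    unfolding cadjoint_def by (rule the_equality[where P = ?adj, OF S uniq])
  then show "bounded_clinear (cadjoint T)" "cinner f (cadjoint T g) = cinner (T f) g"
    using S by simp_all
qed

lemma cinner_cadjoint_left:
  "bounded_clinear T \<Longrightarrow> cinner (cadjoint T f) g = cinner f (T g)"
  by (metis cinner_cadjoint_right cinner_commute)

section \<open>Norm criteria for hyponormality and posinormality\<close>

text \<open>The quadratic form of T* T - T T* at \<open>f\<close> is the difference of the two
  squared norms.\<close>

lemma hyponormalI:
  assumes T: "bounded_clinear T" and le: "\<And>f. norm (cadjoint T f) \<le> norm (T f)"
  shows "hyponormal T"
proof -
  have "cinner (cadjoint T (T f) - T (cadjoint T f)) f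
      = complex_of_real ((norm (T f))\<^sup>2 - (norm (cadjoint T f))\<^sup>2)" for f
    by (simp add: cinner_diff_left cinner_cadjoint_left[OF T] cinner_self
        flip: cinner_cadjoint_right[OF T])
  moreover have "(norm (cadjoint T f))\<^sup>2 \<le> (norm (T f))\<^sup>2" for f
    by (simp add: le power_mono)
  moreover have "bounded_clinear (\<lambda>f. (cadjoint T \<circ> T) f - (T \<circ> cadjoint T) f)"
    by (intro bounded_clinear_diff bounded_clinear_comp bounded_clinear_cadjoint T)
  ultimately show ?thesis
    using T by (simp add: hyponormal_def op_ge_def positive_op_def complex_nonneg_Reals_iff)
qed

lemma posinormalI:
  assumes T: "bounded_clinear T" and le: "\<And>f. norm (cadjoint T f) \<le> C * norm (T f)"
  shows "posinormal T"
proof -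
  \<comment> \<open>With \<open>cadjoint T\<close> as the second operator, whose adjoint is
    \<open>T\<close>, the factorization reads T* W = T.\<close>
  obtain W where W: "bounded_clinear W"
    and fact: "\<And>f g. cinner (T f) (W g) = cinner (cadjoint T f) g"
    using douglas_factorization[OF T bounded_clinear_cadjoint[OF T] le] by blast
  have T_eq: "cadjoint T (W g) = T g" for g
    by (rule cinner_ext) (simp add: cinner_cadjoint_right[OF T] fact cinner_cadjoint_left[OF T])
  have adj_eq: "cadjoint W (T g) = cadjoint T g" for g
  proof (rule cinner_ext)
    fix f
    have "cinner f (cadjoint W (T g)) = cinner (W f) (T g)"
      by (rule cinner_cadjoint_right[OF W])
    also have "\<dots> = cinner f (cadjoint T g)"
      using fact[of g f] by (metis cinner_commute)
    finally show "cinner f (cadjoint W (T g)) = cinner f (cadjoint T g)" .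
  qed
  have "positive_op (W \<circ> cadjoint W)"
    using W by (simp add: positive_op_def bounded_clinear_comp bounded_clinear_cadjoint cinner_self
        complex_nonneg_Reals_iff flip: cinner_cadjoint_right)
  moreover have "T \<circ> cadjoint T = cadjoint T \<circ> (W \<circ> cadjoint W) \<circ> T"
    by (simp add: fun_eq_iff T_eq adj_eq)
  ultimately show ?thesis
    using T by (auto simp: posinormal_def)
qed

section \<open>Operators with an interrupter pair\<close>

lemma op_geD: "S \<ge>\<^sub>o\<^sub>p T \<Longrightarrow> inner (T f) f \<le> inner (S f) f"
  by (auto simp: op_ge_def positive_op_def complex_nonneg_Reals_iff Re_cinner inner_diff_left)

lemma norm_cadjoint_le:
  assumes A: "bounded_clinear A" and eq: "A \<circ> Q \<circ> cadjoint A = cadjoint A \<circ> P \<circ> A"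
    and pos: "\<delta>\<^sub>1 > 0" "\<delta>\<^sub>2 > 0"
    and Q: "(\<lambda>f. \<delta>\<^sub>1 *\<^sub>R Q f) \<ge>\<^sub>o\<^sub>p id" and P: "id \<ge>\<^sub>o\<^sub>p (\<lambda>f. \<delta>\<^sub>2 *\<^sub>R P f)"
  shows "norm (cadjoint A f) \<le> sqrt (\<delta>\<^sub>1 / \<delta>\<^sub>2) * norm (A f)"
proof -
  let ?g = "cadjoint A f"
  \<comment> \<open>Both sides are the real part of the quadratic form at \<open>f\<close> of the
    operator that \<open>eq\<close> writes in two ways.\<close>
  have "inner (Q ?g) ?g = inner (P (A f)) (A f)"
    using fun_cong[OF eq, of f] cinner_cadjoint_right[OF A, of "Q ?g" f]
      cinner_cadjoint_left[OF A, of "P (A f)" f]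
    by (simp flip: Re_cinner)
  moreover have "(norm ?g)\<^sup>2 \<le> \<delta>\<^sub>1 * inner (Q ?g) ?g"
    using op_geD[OF Q, of ?g] by (simp add: power2_norm_eq_inner)
  moreover have "inner (P (A f)) (A f) \<le> (norm (A f))\<^sup>2 / \<delta>\<^sub>2"
    using op_geD[OF P, of "A f"] pos by (simp add: power2_norm_eq_inner field_simps)
  ultimately have "(norm ?g)\<^sup>2 \<le> \<delta>\<^sub>1 * ((norm (A f))\<^sup>2 / \<delta>\<^sub>2)"
    using pos by (smt (verit) mult_left_mono)
  then have "(norm ?g)\<^sup>2 \<le> (sqrt (\<delta>\<^sub>1 / \<delta>\<^sub>2) * norm (A f))\<^sup>2"
    using pos by (simp add: power_mult_distrib)
  then show ?thesis
    by (rule power2_le_imp_le) (use pos in simp)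
qed

theorem corollary5:
  fixes A P Q :: "'a :: chilbert_space \<Rightarrow> 'a"
  assumes "supraposinormal A"
    and "interrupter_pair A Q P"
  shows "((\<exists>\<delta>\<^sub>1 \<delta>\<^sub>2 :: real. \<delta>\<^sub>1 > 0 \<and> \<delta>\<^sub>2 > 0 \<and>
             (\<lambda>f. \<delta>\<^sub>1 *\<^sub>R Q f) \<ge>\<^sub>o\<^sub>p id \<and> id \<ge>\<^sub>o\<^sub>p (\<lambda>f. \<delta>\<^sub>2 *\<^sub>R P f) \<and>
             (\<lambda>f. \<delta>\<^sub>2 *\<^sub>R P f) \<ge>\<^sub>o\<^sub>p (\<lambda>f. 0))
           \<longrightarrow> posinormal A) \<and>
         ((\<exists>\<delta>\<^sub>1 \<delta>\<^sub>2 :: real. \<delta>\<^sub>1 > 0 \<and> \<delta>\<^sub>2 > 0 \<and> \<delta>\<^sub>1 \<le> \<delta>\<^sub>2 \<and>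
             (\<lambda>f. \<delta>\<^sub>1 *\<^sub>R Q f) \<ge>\<^sub>o\<^sub>p id \<and> id \<ge>\<^sub>o\<^sub>p (\<lambda>f. \<delta>\<^sub>2 *\<^sub>R P f) \<and>
             (\<lambda>f. \<delta>\<^sub>2 *\<^sub>R P f) \<ge>\<^sub>o\<^sub>p (\<lambda>f. 0))
           \<longrightarrow> hyponormal A)"
proof -
  have A: "bounded_clinear A" and eq: "A \<circ> Q \<circ> cadjoint A = cadjoint A \<circ> P \<circ> A"
    using assms by (simp_all add: supraposinormal_def interrupter_pair_def)
  have "hyponormal A"
    if "\<delta>\<^sub>1 > 0" "\<delta>\<^sub>2 > 0" "\<delta>\<^sub>1 \<le> \<delta>\<^sub>2" "(\<lambda>f. \<delta>\<^sub>1 *\<^sub>R Q f) \<ge>\<^sub>o\<^sub>p id" "id \<ge>\<^sub>o\<^sub>p (\<lambda>f. \<delta>\<^sub>2 *\<^sub>R P f)"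
    for \<delta>\<^sub>1 \<delta>\<^sub>2 :: real
  proof (rule hyponormalI[OF A])
    fix f
    have "sqrt (\<delta>\<^sub>1 / \<delta>\<^sub>2) * norm (A f) \<le> 1 * norm (A f)"
      using that by (intro mult_right_mono) simp_all
    then show "norm (cadjoint A f) \<le> norm (A f)"
      using norm_cadjoint_le[OF A eq that(1,2,4,5), of f] by simp
  qed
  then show ?thesis
    using posinormalI[OF A norm_cadjoint_le[OF A eq]] by blast
qed

end
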